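(* Let $(M,\omega^1,\ldots,\omega^k,V)$ be a $k$-symplectic manifold with $\dim M=n(k+1)$. For every $x\in M$, there exists a basis $\{e^1,\ldots,e^n;e^\beta_1,\ldots,e^\beta_n\}_{\beta=1,\ldots,k}$ of $T_x^*M$ such that, denoting by $\{e_1,\ldots,e_n;e^1_\beta,\ldots,e^n_\beta\}_{\beta=1,\ldots,k}$ the dual basis of $T_xM$, $$\omega^\beta_x=\sum_{i=1}^n e^i\wedge e^\beta_i,\qquad V_x=\bigoplus_{\alpha=1}^k V_\alpha,\qquad V_\beta=\langle e^1_\beta,\ldots,e^n_\beta\rangle,\qquad \beta=1,\ldots,k.$$
   Context: All manifolds are real, smooth, Hausdorff, connected, second countable and finite-dimensional; all structures are smooth. Let $M$ be an $n(k+1)$-dimensional manifold. A $k$-symplectic structure on $M$ is a family $(\omega^1,\ldots,\omega^k,V)$, where $V$ is an integrable distribution on $M$ of rank $nk$ and $\omega^1,\ldots,\omega^k$ are closed differential two-forms on $M$ such that (1) $\omega^\alpha|_{V\times V}=0$ for $1\leq\alpha\leq k$, and (2) $\bigcap_{\alpha=1}^k\ker\omega^\alpha=\{0\}$, where $\ker\omega^\alpha=\{v\in TM\mid \omega^\alpha(v,\cdot)=0\}$. Then $(M,\omega^1,\ldots,\omega^k,V)$ is called a $k$-symplectic manifold. The notation $V_x$ denotes the fibre of $V$ at $x$, and $\langle\cdots\rangle$ denotes linear span. *)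

theory Defs
  imports "HOL-Analysis.Analysis" "HOL-Library.Function_Algebras"
begin

section \<open>Linear algebra\<close>

text \<open>Tangent and cotangent vectors are functions with values in a real vector space; the vector
  space operations are pointwise.\<close>

instantiation "fun" :: (type, real_vector) real_vector
begin

definition scaleR_fun :: "real \<Rightarrow> ('a \<Rightarrow> 'b) \<Rightarrow> 'a \<Rightarrow> 'b" where
  "scaleR_fun c f = (\<lambda>x. c *\<^sub>R f x)"

instance
  by standard (auto simp: scaleR_fun_def fun_eq_iff scaleR_add_right scaleR_add_left)

end

definition basis_family :: "'i set \<Rightarrow> ('i \<Rightarrow> 'v::real_vector) \<Rightarrow> 'v set \<Rightarrow> bool" where
  "basis_family I b S \<longleftrightarrow> inj_on b I \<and> independent (b ` I) \<and> span (b ` I) = S"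

definition internal_direct_sum :: "'i set \<Rightarrow> ('i \<Rightarrow> 'v::real_vector set) \<Rightarrow> 'v set \<Rightarrow> bool" where
  "internal_direct_sum I W S \<longleftrightarrow>
     (\<forall>i\<in>I. subspace (W i)) \<and>
     S = {(\<Sum>i\<in>I. s i) |s. \<forall>i\<in>I. s i \<in> W i} \<and>
     (\<forall>s. (\<forall>i\<in>I. s i \<in> W i) \<and> (\<Sum>i\<in>I. s i) = 0 \<longrightarrow> (\<forall>i\<in>I. s i = 0))"

text \<open>The dual space of a subspace \<open>S\<close>. Functionals are set to 0 outside \<open>S\<close>, so that each
  functional on \<open>S\<close> is represented by exactly one function.\<close>

definition dual_space :: "'v::real_vector set \<Rightarrow> ('v \<Rightarrow> real) set" where
  "dual_space S = {a. (\<forall>u\<in>S. \<forall>v\<in>S. a (u + v) = a u + a v) \<and>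
                      (\<forall>c. \<forall>v\<in>S. a (c *\<^sub>R v) = c * a v) \<and>
                      (\<forall>v. v \<notin> S \<longrightarrow> a v = 0)}"

definition dual_families :: "'i set \<Rightarrow> ('i \<Rightarrow> 'v \<Rightarrow> real) \<Rightarrow> ('i \<Rightarrow> 'v) \<Rightarrow> bool" where
  "dual_families I a b \<longleftrightarrow> (\<forall>i\<in>I. \<forall>j\<in>I. a i (b j) = (if i = j then 1 else 0))"

definition wedge :: "('v \<Rightarrow> real) \<Rightarrow> ('v \<Rightarrow> real) \<Rightarrow> 'v \<Rightarrow> 'v \<Rightarrow> real" where
  "wedge a b = (\<lambda>u v. a u * b v - a v * b u)"

definition alternating_bilinear_on :: "'v::real_vector set \<Rightarrow> ('v \<Rightarrow> 'v \<Rightarrow> real) \<Rightarrow> bool" where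
  "alternating_bilinear_on S f \<longleftrightarrow>
     (\<forall>u\<in>S. \<forall>v\<in>S. \<forall>w\<in>S. f (u + v) w = f u w + f v w \<and> f w (u + v) = f w u + f w v) \<and>
     (\<forall>c. \<forall>u\<in>S. \<forall>v\<in>S. f (c *\<^sub>R u) v = c * f u v \<and> f u (c *\<^sub>R v) = c * f u v) \<and>
     (\<forall>u\<in>S. f u u = 0)"

section \<open>Smooth maps between Euclidean spaces\<close>

text \<open>\<open>Ck_on m f S\<close>: the function \<open>f\<close> is of class \<open>C\<^sup>m\<close> on the open set \<open>S\<close>, that is, all iterated
  partial derivatives up to order \<open>m\<close> exist and are continuous.\<close>

primrec Ck_on :: "nat \<Rightarrow> ('a::euclidean_space \<Rightarrow> 'b::real_normed_vector) \<Rightarrow> 'a set \<Rightarrow> bool" where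
  "Ck_on 0 f S \<longleftrightarrow> continuous_on S f"
| "Ck_on (Suc m) f S \<longleftrightarrow>
     (\<forall>x\<in>S. f differentiable (at x)) \<and>
     (\<forall>i\<in>Basis. Ck_on m (\<lambda>x. frechet_derivative f (at x) i) S)"

definition smooth_on :: "'a::euclidean_space set \<Rightarrow> ('a \<Rightarrow> 'b::real_normed_vector) \<Rightarrow> bool" where
  "smooth_on S f \<longleftrightarrow> (\<forall>m. Ck_on m f S)"

section \<open>Smooth manifolds\<close>

text \<open>A chart \<open>(U, \<phi>)\<close> consists of an open set \<open>U\<close> and a homeomorphism \<open>\<phi>\<close> from \<open>U\<close> onto an open
  subset of the model space \<open>'e\<close>. The values of \<open>\<phi>\<close> outside \<open>U\<close> are irrelevant.\<close>

type_synonym ('m, 'e) chart = "'m set \<times> ('m \<Rightarrow> 'e)"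

abbreviation chart_dom :: "('m, 'e) chart \<Rightarrow> 'm set" where
  "chart_dom c \<equiv> fst c"

abbreviation chart_map :: "('m, 'e) chart \<Rightarrow> 'm \<Rightarrow> 'e" where
  "chart_map c \<equiv> snd c"

definition chart_inv :: "('m, 'e) chart \<Rightarrow> 'e \<Rightarrow> 'm" where
  "chart_inv c = inv_into (chart_dom c) (chart_map c)"

definition is_chart :: "'m topology \<Rightarrow> ('m, 'e::euclidean_space) chart \<Rightarrow> bool" where
  "is_chart M c \<longleftrightarrow>
     openin M (chart_dom c) \<and> open (chart_map c ` chart_dom c) \<and>
     homeomorphic_map (subtopology M (chart_dom c))
       (top_of_set (chart_map c ` chart_dom c)) (chart_map c)"

definition transition :: "('m, 'e) chart \<Rightarrow> ('m, 'e) chart \<Rightarrow> 'e \<Rightarrow> 'e" where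
  "transition c d = chart_map d \<circ> chart_inv c"

text \<open>The smooth structure is the one generated by the atlas \<open>A\<close>, which need not be maximal.\<close>

definition smooth_manifold :: "'m topology \<Rightarrow> ('m, 'e::euclidean_space) chart set \<Rightarrow> bool" where
  "smooth_manifold M A \<longleftrightarrow>
     Hausdorff_space M \<and> connected_space M \<and> second_countable M \<and>
     (\<forall>c\<in>A. is_chart M c) \<and>
     (\<Union>c\<in>A. chart_dom c) = topspace M \<and>
     (\<forall>c\<in>A. \<forall>d\<in>A. smooth_on (chart_map c ` (chart_dom c \<inter> chart_dom d)) (transition c d))"

text \<open>A tangent vector at \<open>x\<close> assigns to each chart of the atlas around \<open>x\<close> its component vector in
  that chart; the components in two charts are related by the derivative of the transition map.
  On all other pairs the function is set to 0.\<close>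

type_synonym ('m, 'e) tvec = "('m, 'e) chart \<Rightarrow> 'e"

definition tangent_space :: "('m, 'e::euclidean_space) chart set \<Rightarrow> 'm \<Rightarrow> ('m, 'e) tvec set" where
  "tangent_space A x =
     {v. (\<forall>c\<in>A. \<forall>d\<in>A. x \<in> chart_dom c \<and> x \<in> chart_dom d \<longrightarrow>
            v d = frechet_derivative (transition c d) (at (chart_map c x)) (v c)) \<and>
         (\<forall>c. \<not> (c \<in> A \<and> x \<in> chart_dom c) \<longrightarrow> v c = 0)}"

abbreviation cotangent_space ::
    "('m, 'e::euclidean_space) chart set \<Rightarrow> 'm \<Rightarrow> (('m, 'e) tvec \<Rightarrow> real) set" where
  "cotangent_space A x \<equiv> dual_space (tangent_space A x)"

text \<open>The tangent vector at \<open>x\<close> with component vector \<open>h\<close> in the chart \<open>c\<close>; for \<open>h\<close> in the standard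
  basis these are the coordinate vectors \<open>\<partial>\<^sub>h\<close> of \<open>c\<close>.\<close>

definition chart_vec ::
    "('m, 'e::euclidean_space) chart set \<Rightarrow> ('m, 'e) chart \<Rightarrow> 'm \<Rightarrow> 'e \<Rightarrow> ('m, 'e) tvec" where
  "chart_vec A c x h =
     (\<lambda>d. if d \<in> A \<and> x \<in> chart_dom d
          then frechet_derivative (transition c d) (at (chart_map c x)) h else 0)"

section \<open>Differential two-forms\<close>

type_synonym ('m, 'e) tensor2 = "'m \<Rightarrow> ('m, 'e) tvec \<Rightarrow> ('m, 'e) tvec \<Rightarrow> real"

text \<open>The component \<open>\<omega>(\<partial>\<^sub>h, \<partial>\<^sub>k)\<close> in the chart \<open>c\<close>, as a function of the coordinates.\<close>

definition form_coeff ::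
    "('m, 'e::euclidean_space) chart set \<Rightarrow> ('m, 'e) chart \<Rightarrow> ('m, 'e) tensor2 \<Rightarrow>
     'e \<Rightarrow> 'e \<Rightarrow> 'e \<Rightarrow> real" where
  "form_coeff A c \<omega> h k =
     (\<lambda>z. \<omega> (chart_inv c z) (chart_vec A c (chart_inv c z) h) (chart_vec A c (chart_inv c z) k))"

definition two_form ::
    "'m topology \<Rightarrow> ('m, 'e::euclidean_space) chart set \<Rightarrow> ('m, 'e) tensor2 \<Rightarrow> bool" where
  "two_form M A \<omega> \<longleftrightarrow>
     (\<forall>x\<in>topspace M. alternating_bilinear_on (tangent_space A x) (\<omega> x)) \<and>
     (\<forall>c\<in>A. \<forall>h\<in>Basis. \<forall>k\<in>Basis.
        smooth_on (chart_map c ` chart_dom c) (form_coeff A c \<omega> h k))"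

text \<open>\<open>d\<omega> = 0\<close> in local coordinates: the components of the exterior derivative of a two-form are
  \<open>(d\<omega>)\<^sub>h\<^sub>k\<^sub>l = \<partial>\<^sub>h \<omega>\<^sub>k\<^sub>l + \<partial>\<^sub>k \<omega>\<^sub>l\<^sub>h + \<partial>\<^sub>l \<omega>\<^sub>h\<^sub>k\<close>.\<close>

definition ext_deriv_coeff ::
    "('m, 'e::euclidean_space) chart set \<Rightarrow> ('m, 'e) chart \<Rightarrow> ('m, 'e) tensor2 \<Rightarrow>
     'e \<Rightarrow> 'e \<Rightarrow> 'e \<Rightarrow> 'e \<Rightarrow> real" where
  "ext_deriv_coeff A c \<omega> h k l =
     (\<lambda>z. frechet_derivative (form_coeff A c \<omega> k l) (at z) h
        + frechet_derivative (form_coeff A c \<omega> l h) (at z) k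
        + frechet_derivative (form_coeff A c \<omega> h k) (at z) l)"

definition closed_form ::
    "('m, 'e::euclidean_space) chart set \<Rightarrow> ('m, 'e) tensor2 \<Rightarrow> bool" where
  "closed_form A \<omega> \<longleftrightarrow>
     (\<forall>c\<in>A. \<forall>z\<in>chart_map c ` chart_dom c. \<forall>h\<in>Basis. \<forall>k\<in>Basis. \<forall>l\<in>Basis.
        ext_deriv_coeff A c \<omega> h k l z = 0)"

definition form_kernel ::
    "('m, 'e::euclidean_space) chart set \<Rightarrow> ('m, 'e) tensor2 \<Rightarrow> 'm \<Rightarrow> ('m, 'e) tvec set" where
  "form_kernel A \<omega> x = {v \<in> tangent_space A x. \<forall>w\<in>tangent_space A x. \<omega> x v w = 0}"

section \<open>Integrable distributions\<close>

definition smooth_vector_field_on ::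
    "('m, 'e::euclidean_space) chart set \<Rightarrow> 'm set \<Rightarrow> ('m \<Rightarrow> ('m, 'e) tvec) \<Rightarrow> bool" where
  "smooth_vector_field_on A U X \<longleftrightarrow>
     (\<forall>x\<in>U. X x \<in> tangent_space A x) \<and>
     (\<forall>c\<in>A. smooth_on (chart_map c ` (chart_dom c \<inter> U)) (\<lambda>z. X (chart_inv c z) c))"

text \<open>A smooth distribution of rank \<open>r\<close>, that is, a smooth vector subbundle of the tangent bundle.\<close>

definition distribution ::
    "'m topology \<Rightarrow> ('m, 'e::euclidean_space) chart set \<Rightarrow> nat \<Rightarrow>
     ('m \<Rightarrow> ('m, 'e) tvec set) \<Rightarrow> bool" where
  "distribution M A r V \<longleftrightarrow>
     (\<forall>x\<in>topspace M. \<exists>U X. openin M U \<and> x \<in> U \<and>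
        (\<forall>j\<in>{1..r}. smooth_vector_field_on A U (X j)) \<and>
        (\<forall>y\<in>U. V y \<subseteq> tangent_space A y \<and> basis_family {1..r} (\<lambda>j. X j y) (V y)))"

definition smooth_into ::
    "'m topology \<Rightarrow> ('m, 'e::euclidean_space) chart set \<Rightarrow> 'e set \<Rightarrow> ('e \<Rightarrow> 'm) \<Rightarrow> bool" where
  "smooth_into M A W g \<longleftrightarrow>
     continuous_map (top_of_set W) M g \<and>
     (\<forall>c\<in>A. smooth_on {w \<in> W. g w \<in> chart_dom c} (chart_map c \<circ> g))"

definition differential ::
    "('m, 'e::euclidean_space) chart set \<Rightarrow> ('e \<Rightarrow> 'm) \<Rightarrow> 'e \<Rightarrow> 'e \<Rightarrow> ('m, 'e) tvec" where
  "differential A g w h =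
     (\<lambda>c. if c \<in> A \<and> g w \<in> chart_dom c
          then frechet_derivative (chart_map c \<circ> g) (at w) h else 0)"

text \<open>Integrability: through every point there passes an integral manifold, that is, an immersed
  submanifold whose tangent space at each of its points \<open>y\<close> is \<open>V y\<close>. Integral manifolds are
  given by local parametrizations, i.e. injective immersions of \<open>W \<inter> S\<close> into the manifold, where
  \<open>W\<close> is open in \<open>'e\<close> and the linear subspace \<open>S\<close> of \<open>'e\<close> with \<open>dim S = r\<close> plays the role of
  \<open>\<real>\<^sup>r\<close>. (A smooth map on a relatively open subset of \<open>S\<close> is locally the restriction of a smooth map
  on an open subset of \<open>'e\<close>.)\<close>

definition integral_parametrization ::
    "'m topology \<Rightarrow> ('m, 'e::euclidean_space) chart set \<Rightarrow> nat \<Rightarrow>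
     ('m \<Rightarrow> ('m, 'e) tvec set) \<Rightarrow> 'e set \<Rightarrow> 'e set \<Rightarrow> ('e \<Rightarrow> 'm) \<Rightarrow> bool" where
  "integral_parametrization M A r V S W g \<longleftrightarrow>
     subspace S \<and> dim S = r \<and> open W \<and> smooth_into M A W g \<and> inj_on g (W \<inter> S) \<and>
     (\<forall>w\<in>W \<inter> S. inj_on (differential A g w) S \<and> differential A g w ` S = V (g w))"

definition integrable_distribution ::
    "'m topology \<Rightarrow> ('m, 'e::euclidean_space) chart set \<Rightarrow> nat \<Rightarrow>
     ('m \<Rightarrow> ('m, 'e) tvec set) \<Rightarrow> bool" where
  "integrable_distribution M A r V \<longleftrightarrow>
     distribution M A r V \<and>
     (\<forall>x\<in>topspace M. \<exists>S W g. integral_parametrization M A r V S W g \<and> x \<in> g ` (W \<inter> S))"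

section \<open>k-symplectic manifolds\<close>

text \<open>The dimension of the manifold is that of the model space \<open>'e\<close>.\<close>

definition k_symplectic_manifold ::
    "nat \<Rightarrow> nat \<Rightarrow> 'm topology \<Rightarrow> ('m, 'e::euclidean_space) chart set \<Rightarrow>
     (nat \<Rightarrow> ('m, 'e) tensor2) \<Rightarrow> ('m \<Rightarrow> ('m, 'e) tvec set) \<Rightarrow> bool" where
  "k_symplectic_manifold n k M A \<omega> V \<longleftrightarrow>
     smooth_manifold M A \<and> DIM('e) = n * (k + 1) \<and>
     integrable_distribution M A (n * k) V \<and>
     (\<forall>\<alpha>\<in>{1..k}. two_form M A (\<omega> \<alpha>) \<and> closed_form A (\<omega> \<alpha>)) \<and>
     (\<forall>\<alpha>\<in>{1..k}. \<forall>x\<in>topspace M. \<forall>u\<in>V x. \<forall>v\<in>V x. \<omega> \<alpha> x u v = 0) \<and>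
     (\<forall>x\<in>topspace M. (\<Inter>\<alpha>\<in>{1..k}. form_kernel A (\<omega> \<alpha>) x) = {0})"

text \<open>Index set of the bases in the theorem: \<open>Inl i\<close> indexes \<open>e\<^sup>i\<close> (and its dual \<open>e\<^sub>i\<close>), and
  \<open>Inr (\<beta>, i)\<close> indexes \<open>e\<^sup>\<beta>\<^sub>i\<close> (and its dual \<open>e\<^sup>i\<^sub>\<beta>\<close>).\<close>

abbreviation ks_index :: "nat \<Rightarrow> nat \<Rightarrow> (nat + nat \<times> nat) set" where
  "ks_index n k \<equiv> {1..n} <+> ({1..k} \<times> {1..n})"

end

theory Submission
  imports Defs
begin

text \<open>The assertion concerns a single tangent space \<open>T\<close> and the linear data on it. Since each
  form vanishes on \<open>V \<times> V\<close>, the contractions \<open>\<omega> \<alpha> v\<close> with \<open>v \<in> V\<close> are functionals on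
  \<open>T / V\<close>, and because the forms have no common kernel the map
  \<open>v \<mapsto> (\<omega> 1 v, \<dots>, \<omega> k v)\<close> from \<open>V\<close> to the \<open>k\<close>-fold sum of the dual of \<open>T / V\<close> is injective.
  Both sides have dimension \<open>n k\<close>, so it is an isomorphism (\<open>separating_functionals\<close>), and the
  copies of the dual of \<open>T / V\<close> pull back to the summands of \<open>V\<close>.

  It remains to choose a complement of \<open>V\<close> on which all forms vanish. Any vectors
  \<open>e' 1, \<dots>, e' n\<close> that complete a basis of \<open>V\<close> to one of \<open>T\<close> can be corrected by elements of
  \<open>V\<close>: by the isomorphism there are \<open>w i \<in> V\<close> with
  \<open>\<omega> \<alpha> (w i) (e' j) = - \<omega> \<alpha> (e' i) (e' j) / 2\<close> for all \<open>\<alpha>\<close> and \<open>j\<close>, and the two correction terms in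
  \<open>\<omega> \<alpha> (e' i + w i) (e' j + w j)\<close> cancel the original value. With \<open>e i = e' i + w i\<close>, the
  vectors \<open>d (\<alpha>, i)\<close> of \<open>V\<close> dual to the \<open>e j\<close> under \<open>\<omega> \<alpha>\<close>, and orthogonal to them under the
  other forms, complete the basis. The dual basis consists of the contractions of the forms with
  these vectors, so independence and the formula for \<open>\<omega> \<beta>\<close> are read off from
  the values of the forms on basis vectors (\<open>polarized_forms_normal_form\<close>).

  The isomorphism also gives half of the dimension count: injectivity alone shows that \<open>T / V\<close> has
  dimension at least \<open>n\<close>, so only the upper bound \<open>n (k + 1)\<close> for the dimension of the tangent
  space is needed, and this one holds because a tangent vector is determined by its
  components in one chart.\<close>

section \<open>Dual spaces and dual families\<close>

lemma sum_fun_apply: "(\<Sum>i\<in>I. f i) x = (\<Sum>i\<in>I. (f i x :: 'b::comm_monoid_add))"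
  by (induction I rule: infinite_finite_induct) auto

lemma dual_space_add: "a \<in> dual_space S \<Longrightarrow> u \<in> S \<Longrightarrow> v \<in> S \<Longrightarrow> a (u + v) = a u + a v"
  and dual_space_scale: "a \<in> dual_space S \<Longrightarrow> v \<in> S \<Longrightarrow> a (c *\<^sub>R v) = c * a v"
  and dual_space_outside: "a \<in> dual_space S \<Longrightarrow> v \<notin> S \<Longrightarrow> a v = 0"
  by (auto simp: dual_space_def)

lemma subspace_dual_space: "subspace (dual_space S)"
  by (auto simp: subspace_def dual_space_def scaleR_fun_def algebra_simps)

text \<open>Elements of \<open>dual_space S\<close> are linear only along \<open>S\<close>. Composing them with a projection onto
  \<open>S\<close> makes the results on globally linear maps applicable.\<close>

lemma dual_space_extend:
  fixes S :: "'v::real_vector set"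
  assumes "subspace S" "a \<in> dual_space S"
  shows "\<exists>g :: 'v \<Rightarrow> real. linear g \<and> (\<forall>v\<in>S. g v = a v)"
proof -
  obtain p :: "'v \<Rightarrow> 'v" where p: "p ` UNIV \<subseteq> S" "linear p" "\<forall>v\<in>S. p v = v"
    using linear_exists_left_inverse_on[OF linear_id assms(1)] by auto
  have "linear (a \<circ> p)"
  proof (rule linearI)
    fix u v
    show "(a \<circ> p) (u + v) = (a \<circ> p) u + (a \<circ> p) v"
      using p(1) by (auto simp: linear_add[OF p(2)] intro!: dual_space_add[OF assms(2)])
  next
    fix c u
    show "(a \<circ> p) (c *\<^sub>R u) = c *\<^sub>R (a \<circ> p) u"
      using p(1) by (auto simp: linear_scale[OF p(2)] intro!: dual_space_scale[OF assms(2)])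
  qed
  with p(3) show ?thesis by (intro exI[of _ "a \<circ> p"]) auto
qed

lemma dual_space_sum:
  assumes "subspace S" "a \<in> dual_space S" "\<And>i. i \<in> I \<Longrightarrow> w i \<in> S"
  shows "a (\<Sum>i\<in>I. w i) = (\<Sum>i\<in>I. a (w i))"
proof -
  obtain g where g: "linear g" "\<And>v. v \<in> S \<Longrightarrow> g v = a v"
    using dual_space_extend[OF assms(1,2)] by blast
  have "g (\<Sum>i\<in>I. w i) = (\<Sum>i\<in>I. g (w i))"
    by (rule linear_sum[OF g(1)])
  with assms g(2) show ?thesis by (simp add: subspace_sum)
qed

lemma dual_space_eq_on_span:
  assumes "a \<in> dual_space (span B)" "a' \<in> dual_space (span B)" "\<And>v. v \<in> B \<Longrightarrow> a v = a' v"
  shows "a = a'"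
proof
  fix v
  obtain g where g: "linear g" "\<And>v. v \<in> span B \<Longrightarrow> g v = a v"
    using dual_space_extend[OF subspace_span assms(1)] by blast
  obtain g' where g': "linear g'" "\<And>v. v \<in> span B \<Longrightarrow> g' v = a' v"
    using dual_space_extend[OF subspace_span assms(2)] by blast
  show "a v = a' v"
  proof (cases "v \<in> span B")
    case True
    have "g v = g' v"
      using linear_eq_on_span[OF g(1) g'(1) _ True] g(2) g'(2) assms(3) span_base by metis
    with True g g' show ?thesis by simp
  qed (use assms dual_space_outside in metis)
qed

text \<open>The functional \<open>L i\<close> vanishes on the span of the other \<open>b j\<close>, but not at \<open>b i\<close>.\<close>

lemma biorthogonal_independent:
  fixes L :: "'i \<Rightarrow> 'v::real_vector \<Rightarrow> real"
  assumes L: "\<And>i. i \<in> I \<Longrightarrow> linear (L i)"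
    and d: "\<And>i j. i \<in> I \<Longrightarrow> j \<in> I \<Longrightarrow> L i (b j) = (if i = j then 1 else 0)"
  shows "inj_on b I \<and> independent (b ` I)"
proof
  show inj: "inj_on b I"
    using d by (metis inj_onI zero_neq_one)
  show "independent (b ` I)"
  proof
    assume "dependent (b ` I)"
    then obtain i where i: "i \<in> I" and s: "b i \<in> span (b ` I - {b i})"
      unfolding dependent_def by auto
    have "L i (b i) = 0"
      by (rule linear_eq_0_on_span[OF L[OF i] _ s]) (use d i inj in auto)
    with d[OF i i] show False by simp
  qed
qed

text \<open>Independence is \<open>biorthogonal_independent\<close>, used for \<open>b\<close> with the functionals \<open>\<theta> i\<close> and for
  \<open>\<theta>\<close> with the evaluations at the \<open>b i\<close>. The family \<open>\<theta>\<close> spans because a functional \<open>a\<close> agrees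
  on the \<open>b j\<close> with \<open>\<Sum>i. a (b i) \<theta> i\<close>.\<close>

lemma dual_families_basis:
  fixes b :: "'i \<Rightarrow> 'v::real_vector"
  assumes I: "finite I" and span: "span (b ` I) = S"
    and \<theta>: "\<And>i. i \<in> I \<Longrightarrow> \<theta> i \<in> dual_space S" and dual: "dual_families I \<theta> b"
  shows "basis_family I b S" "basis_family I \<theta> (dual_space S)"
proof -
  have bS: "b i \<in> S" if "i \<in> I" for i
    using that span_superset[of "b ` I"] span by auto
  have S: "subspace S" using span subspace_span by metis
  have d: "\<theta> i (b j) = (if i = j then 1 else 0)" if "i \<in> I" "j \<in> I" for i j
    using dual that by (auto simp: dual_families_def)
  have "\<exists>g. linear g \<and> (\<forall>v\<in>S. g v = \<theta> i v)" if "i \<in> I" for i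
    by (rule dual_space_extend[OF S \<theta>[OF that]])
  then obtain L where L: "\<And>i. i \<in> I \<Longrightarrow> linear (L i) \<and> (\<forall>v\<in>S. L i v = \<theta> i v)"
    by metis
  show "basis_family I b S"
    unfolding basis_family_def
    using biorthogonal_independent[of I L b] L bS d span by auto
  have ev: "linear (\<lambda>a. a (b i) :: real)" for i
    by (rule linearI) (auto simp: scaleR_fun_def)
  have ind: "inj_on \<theta> I \<and> independent (\<theta> ` I)"
    by (rule biorthogonal_independent[of I "\<lambda>i a. a (b i)"]) (auto simp: d ev)
  have "a \<in> span (\<theta> ` I)" if a: "a \<in> dual_space S" for a
  proof -
    let ?a = "\<Sum>i\<in>I. a (b i) *\<^sub>R \<theta> i"
    have "?a \<in> dual_space S"
      by (intro subspace_sum subspace_scale subspace_dual_space \<theta>)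
    moreover have "?a (b j) = a (b j)" if "j \<in> I" for j
    proof -
      have "?a (b j) = (\<Sum>i\<in>I. if i = j then a (b j) else 0)"
        unfolding sum_fun_apply using d that by (intro sum.cong) (auto simp: scaleR_fun_def)
      with that I show ?thesis by simp
    qed
    ultimately have "a = ?a"
      using a span by (intro dual_space_eq_on_span[of _ "b ` I"]) auto
    moreover have "?a \<in> span (\<theta> ` I)"
      by (intro span_sum span_scale span_base) auto
    ultimately show ?thesis by simp
  qed
  moreover have "span (\<theta> ` I) \<subseteq> dual_space S"
    by (intro span_minimal subspace_dual_space) (use \<theta> in auto)
  ultimately show "basis_family I \<theta> (dual_space S)"
    unfolding basis_family_def using ind by blast
qed

section \<open>Functionals separating the points of a subspace\<close>

text \<open>The functionals together map \<open>V\<close> injectively into \<open>\<real>\<^sup>J\<close>. This bounds the dimension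
  of \<open>V\<close> by \<open>card J\<close>, and when the two agree the map is onto, since a vector missed by it
  could be added to the image of a basis.\<close>

lemma separating_functionals:
  fixes \<phi> :: "'j \<Rightarrow> 'v::real_vector \<Rightarrow> real"
  assumes J: "finite J" and V: "basis_family I X V"
    and \<phi>: "\<And>j. j \<in> J \<Longrightarrow> \<phi> j \<in> dual_space V"
    and sep: "\<And>v. v \<in> V \<Longrightarrow> (\<And>j. j \<in> J \<Longrightarrow> \<phi> j v = 0) \<Longrightarrow> v = 0"
  shows "card I \<le> card J" "card I = card J \<Longrightarrow> \<exists>v\<in>V. \<forall>j\<in>J. \<phi> j v = f j"
proof -
  have X: "inj_on X I" "independent (X ` I)" "span (X ` I) = V"
    using V by (auto simp: basis_family_def)
  have sV: "subspace V" using X(3) subspace_span by metis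
  have "\<exists>g. linear g \<and> (\<forall>v\<in>V. g v = \<phi> j v)" if "j \<in> J" for j
    by (rule dual_space_extend[OF sV \<phi>[OF that]])
  then obtain g where "\<And>j. j \<in> J \<Longrightarrow> linear (g j) \<and> (\<forall>v\<in>V. g j v = \<phi> j v)"
    by metis
  then have g: "\<And>j. j \<in> J \<Longrightarrow> linear (g j)"
      "\<And>j v. j \<in> J \<Longrightarrow> v \<in> V \<Longrightarrow> g j v = \<phi> j v"
    by auto
  define \<Phi> where "\<Phi> v = (\<lambda>j. if j \<in> J then g j v else 0)" for v
  have lin: "linear \<Phi>"
    by (rule linearI)
      (auto simp: \<Phi>_def fun_eq_iff scaleR_fun_def linear_add[OF g(1)] linear_scale[OF g(1)])
  have "v = 0" if "v \<in> V" "\<Phi> v = 0" for v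
  proof (rule sep[OF that(1)])
    fix j assume "j \<in> J"
    with fun_cong[OF that(2), of j] g(2)[OF _ that(1)] show "\<phi> j v = 0" by (simp add: \<Phi>_def)
  qed
  then have inj: "inj_on \<Phi> V"
    using linear_injective_on_subspace_0[OF lin sV] by blast
  (* The coordinate functions span the real functions supported on J. *)
  define E :: "('j \<Rightarrow> real) set" where "E = (\<lambda>j i. if i = j then 1 else 0) ` J"
  have E: "finite E" "card E \<le> card J"
    using J by (auto simp: E_def card_image_le)
  have inE: "h \<in> span E" if "\<And>j. j \<notin> J \<Longrightarrow> h j = 0" for h
  proof -
    have "h = (\<Sum>j\<in>J. h j *\<^sub>R (\<lambda>i. if i = j then 1 else 0))"
    proof
      fix i
      show "h i = (\<Sum>j\<in>J. h j *\<^sub>R (\<lambda>i. if i = j then 1 else 0)) i"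
        using J that by (simp add: sum_fun_apply scaleR_fun_def if_distrib cong: if_cong)
    qed
    also have "\<dots> \<in> span E"
      by (intro span_sum span_scale span_base) (auto simp: E_def)
    finally show ?thesis .
  qed
  let ?Y = "\<Phi> ` X ` I"
  have ind: "independent ?Y"
    using linear_independent_injective_image[OF lin X(2)] inj X(3) by simp
  have YE: "?Y \<subseteq> span E" by (auto simp: \<Phi>_def intro!: inE)
  have cY: "card ?Y = card I"
    using inj X span_superset[of "X ` I"] by (metis card_image inj_on_subset)
  show le: "card I \<le> card J"
    using independent_span_bound[OF E(1) ind YE] E(2) cY by simp
  assume eq: "card I = card J"
  define h where "h = (\<lambda>j. if j \<in> J then f j else 0)"
  have hE: "h \<in> span E" by (rule inE) (simp add: h_def)
  have "h \<in> span ?Y"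
  proof (rule ccontr)
    assume n: "h \<notin> span ?Y"
    have "independent (insert h ?Y)" "insert h ?Y \<subseteq> span E"
      using independent_insertI[OF n ind] YE hE by auto
    from independent_span_bound[OF E(1) this]
    have "card (insert h ?Y) \<le> card J" "finite ?Y" using E(2) by auto
    moreover have "h \<notin> ?Y" using n by (rule contrapos_nn) (rule span_base)
    ultimately show False using cY eq by simp
  qed
  then have "h \<in> \<Phi> ` V"
    by (simp only: linear_span_image[OF lin] X(3))
  then obtain v where v: "v \<in> V" "h = \<Phi> v" by blast
  have "\<phi> j v = f j" if "j \<in> J" for j
    using fun_cong[OF v(2), of j] that g(2)[OF that v(1)] by (simp add: \<Phi>_def h_def)
  with v(1) show "\<exists>v\<in>V. \<forall>j\<in>J. \<phi> j v = f j" by blast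
qed

section \<open>Alternating forms and direct sums\<close>

lemma alternating_bilinear_on_antisym:
  assumes "alternating_bilinear_on S f" "subspace S" "u \<in> S" "v \<in> S"
  shows "f u v = - f v u"
proof -
  have "u + v \<in> S" using assms subspace_add by blast
  then have "f (u + v) (u + v) = 0" "f u u = 0" "f v v = 0"
    using assms by (auto simp: alternating_bilinear_on_def)
  moreover have "f (u + v) (u + v) = f u u + f u v + (f v u + f v v)"
    using assms \<open>u + v \<in> S\<close> unfolding alternating_bilinear_on_def by metis
  ultimately show ?thesis by simp
qed

lemma contraction_in_dual_space:
  assumes "alternating_bilinear_on S f" "subspace W" "W \<subseteq> S" "w \<in> S"
  shows "(\<lambda>v. if v \<in> W then f v w else 0) \<in> dual_space W"
    and "(\<lambda>v. if v \<in> W then f w v else 0) \<in> dual_space W"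
proof -
  have add: "f (u + v) w = f u w + f v w" "f w (u + v) = f w u + f w v"
    if "u \<in> W" "v \<in> W" for u v
    using assms that unfolding alternating_bilinear_on_def by blast+
  have scale: "f (c *\<^sub>R v) w = c * f v w" "f w (c *\<^sub>R v) = c * f w v" if "v \<in> W" for c v
    using assms that unfolding alternating_bilinear_on_def by blast+
  show "(\<lambda>v. if v \<in> W then f v w else 0) \<in> dual_space W"
    "(\<lambda>v. if v \<in> W then f w v else 0) \<in> dual_space W"
    by (simp_all add: dual_space_def add scale subspace_add[OF assms(2)] subspace_scale[OF assms(2)])
qed

lemma alternating_bilinear_on_eq_on_span:
  assumes f: "alternating_bilinear_on (span B) f" and g: "alternating_bilinear_on (span B) g"
    and eq: "\<And>u v. u \<in> B \<Longrightarrow> v \<in> B \<Longrightarrow> f u v = g u v"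
    and u: "u \<in> span B" and v: "v \<in> span B"
  shows "f u v = g u v"
proof -
  have left: "(\<lambda>u. if u \<in> span B then h u w else 0) \<in> dual_space (span B)"
    and right: "(\<lambda>u. if u \<in> span B then h w u else 0) \<in> dual_space (span B)"
    if "alternating_bilinear_on (span B) h" "w \<in> span B" for h w
    using contraction_in_dual_space[OF that(1) subspace_span order_refl that(2)] .
  have 1: "f u w = g u w" if "w \<in> B" for w
    using fun_cong[OF dual_space_eq_on_span[OF left[OF f span_base] left[OF g span_base]],
        of w w u] that eq u by (simp add: span_base)
  show ?thesis
    using fun_cong[OF dual_space_eq_on_span[OF right[OF f u] right[OF g u]], of v] 1 v
    by (simp add: span_base)
qed

lemma alternating_bilinear_on_sum_wedge:
  assumes "\<And>i. i \<in> I \<Longrightarrow> a i \<in> dual_space S" "\<And>i. i \<in> I \<Longrightarrow> a' i \<in> dual_space S"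
  shows "alternating_bilinear_on S (\<lambda>u v. \<Sum>i\<in>I. wedge (a i) (a' i) u v)"
proof -
  have add: "wedge (a i) (a' i) (u + v) w = wedge (a i) (a' i) u w + wedge (a i) (a' i) v w"
    "wedge (a i) (a' i) w (u + v) = wedge (a i) (a' i) w u + wedge (a i) (a' i) w v"
    if "i \<in> I" "u \<in> S" "v \<in> S" for i u v w
    using that unfolding wedge_def
    by (simp_all add: dual_space_add[OF assms(1)] dual_space_add[OF assms(2)] algebra_simps)
  have scale: "wedge (a i) (a' i) (c *\<^sub>R u) w = c * wedge (a i) (a' i) u w"
    "wedge (a i) (a' i) w (c *\<^sub>R u) = c * wedge (a i) (a' i) w u"
    if "i \<in> I" "u \<in> S" for i c u w
    using that unfolding wedge_def
    by (simp_all add: dual_space_scale[OF assms(1)] dual_space_scale[OF assms(2)] algebra_simps)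
  have "wedge (a i) (a' i) u u = 0" for i u
    by (simp add: wedge_def)
  then show ?thesis
    by (simp add: alternating_bilinear_on_def add scale sum.distrib sum_distrib_left)
qed

text \<open>The linear maps \<open>p \<alpha>\<close> that kill all basis vectors outside the block \<open>\<alpha>\<close> are the
  projections of the direct sum: \<open>\<Sum>\<alpha>. p \<alpha>\<close> is the identity, and \<open>p \<alpha>\<close> picks the summand
  \<open>s \<alpha>\<close> from \<open>\<Sum>\<alpha>. s \<alpha>\<close>.\<close>

lemma internal_direct_sum_blocks:
  fixes d :: "'a \<times> 'j \<Rightarrow> 'v::real_vector"
  assumes I: "finite I" and inj: "inj_on d (I \<times> J)" and ind: "independent (d ` (I \<times> J))"
  shows "internal_direct_sum I (\<lambda>\<alpha>. span {d (\<alpha>, j) |j. j \<in> J}) (span (d ` (I \<times> J)))"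
    (is "internal_direct_sum I ?W ?V")
proof -
  have "\<exists>p. linear p \<and> (\<forall>x\<in>d ` (I \<times> J). p x = (if fst (inv_into (I \<times> J) d x) = \<alpha> then x else 0))"
    for \<alpha>
    by (rule linear_independent_extend[OF ind])
  then obtain p where p0: "\<And>\<alpha>. linear (p \<alpha>) \<and>
      (\<forall>x\<in>d ` (I \<times> J). p \<alpha> x = (if fst (inv_into (I \<times> J) d x) = \<alpha> then x else 0))"
    by metis
  have lin: "linear (p \<alpha>)" for \<alpha>
    using p0 by blast
  have p: "p \<alpha> (d (\<beta>, j)) = (if \<beta> = \<alpha> then d (\<beta>, j) else 0)" if "\<beta> \<in> I" "j \<in> J" for \<alpha> \<beta> j
    using that inj p0[of \<alpha>] by simp
  have pW: "p \<alpha> w = (if \<beta> = \<alpha> then w else 0)" if "\<beta> \<in> I" "w \<in> ?W \<beta>" for \<alpha> \<beta> w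
  proof (cases "\<beta> = \<alpha>")
    case True
    have "p \<alpha> w = id w"
      by (rule linear_eq_on_span[OF lin linear_id _ that(2)]) (use that True p in auto)
    with True show ?thesis by simp
  next
    case False
    have "p \<alpha> w = 0"
      by (rule linear_eq_0_on_span[OF lin _ that(2)]) (use that False p in auto)
    with False show ?thesis by simp
  qed
  have pV: "p \<alpha> v \<in> ?W \<alpha>" if "v \<in> ?V" for \<alpha> v
  proof -
    have "d ` (I \<times> J) \<subseteq> p \<alpha> -` ?W \<alpha>"
      using p by (auto intro!: span_base span_zero)
    then have "?V \<subseteq> p \<alpha> -` ?W \<alpha>"
      by (intro span_minimal linear_subspace_vimage lin subspace_span)
    with that show ?thesis by auto
  qed
  have sump: "v = (\<Sum>\<alpha>\<in>I. p \<alpha> v)" if "v \<in> ?V" for v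
  proof -
    have "id v = (\<lambda>v. \<Sum>\<alpha>\<in>I. p \<alpha> v) v"
    proof (rule linear_eq_on_span[OF linear_id _ _ that])
      show "linear (\<lambda>v. \<Sum>\<alpha>\<in>I. p \<alpha> v)"
        by (intro linear_compose_sum ballI lin)
      show "id x = (\<Sum>\<alpha>\<in>I. p \<alpha> x)" if "x \<in> d ` (I \<times> J)" for x
        using that I by (auto simp: p)
    qed
    then show ?thesis by simp
  qed
  show ?thesis
    unfolding internal_direct_sum_def
  proof (intro conjI ballI allI impI)
    show "subspace (?W \<alpha>)" for \<alpha> by (rule subspace_span)
    show "?V = {\<Sum>\<alpha>\<in>I. s \<alpha> |s. \<forall>\<alpha>\<in>I. s \<alpha> \<in> ?W \<alpha>}"
    proof (intro equalityI subsetI)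
      fix v assume "v \<in> ?V"
      with sump pV show "v \<in> {\<Sum>\<alpha>\<in>I. s \<alpha> |s. \<forall>\<alpha>\<in>I. s \<alpha> \<in> ?W \<alpha>}" by blast
    next
      fix v assume "v \<in> {\<Sum>\<alpha>\<in>I. s \<alpha> |s. \<forall>\<alpha>\<in>I. s \<alpha> \<in> ?W \<alpha>}"
      then obtain s where "v = (\<Sum>\<alpha>\<in>I. s \<alpha>)" and s: "\<And>\<alpha>. \<alpha> \<in> I \<Longrightarrow> s \<alpha> \<in> ?W \<alpha>" by blast
      moreover have "?W \<alpha> \<subseteq> ?V" if "\<alpha> \<in> I" for \<alpha>
        using that by (intro span_mono) auto
      ultimately show "v \<in> ?V" by (auto intro!: span_sum)
    qed
    fix s \<alpha> assume s: "(\<forall>\<alpha>\<in>I. s \<alpha> \<in> ?W \<alpha>) \<and> (\<Sum>\<alpha>\<in>I. s \<alpha>) = 0" and \<alpha>: "\<alpha> \<in> I"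
    have "0 = p \<alpha> (\<Sum>\<beta>\<in>I. s \<beta>)"
      using s linear_0[OF lin] by simp
    also have "\<dots> = (\<Sum>\<beta>\<in>I. if \<beta> = \<alpha> then s \<beta> else 0)"
      unfolding linear_sum[OF lin] using s pW by (intro sum.cong) auto
    also have "\<dots> = s \<alpha>" using \<alpha> I by simp
    finally show "s \<alpha> = 0" by simp
  qed
qed

section \<open>The linear normal form\<close>

text \<open>The dimension of \<open>T\<close> is only bounded from above; that it equals \<open>n (k + 1)\<close> is a consequence
  of the nondegeneracy. For \<open>k = 0\<close> nondegeneracy forces \<open>T = 0\<close>, so that the statement would
  fail for \<open>n > 0\<close>.\<close>

lemma polarized_forms_normal_form:
  fixes T V :: "'v::real_vector set" and \<omega> :: "nat \<Rightarrow> 'v \<Rightarrow> 'v \<Rightarrow> real"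
  assumes T: "subspace T"
    and bound: "\<And>B. independent B \<Longrightarrow> B \<subseteq> T \<Longrightarrow> finite B \<and> card B \<le> n * (k + 1)"
    and VT: "V \<subseteq> T" and X: "basis_family {1..n * k} X V" and k: "0 < k"
    and alt: "\<And>\<alpha>. \<alpha> \<in> {1..k} \<Longrightarrow> alternating_bilinear_on T (\<omega> \<alpha>)"
    and iso: "\<And>\<alpha> u v. \<alpha> \<in> {1..k} \<Longrightarrow> u \<in> V \<Longrightarrow> v \<in> V \<Longrightarrow> \<omega> \<alpha> u v = 0"
    and nondeg: "\<And>v. v \<in> T \<Longrightarrow> (\<And>\<alpha> w. \<alpha> \<in> {1..k} \<Longrightarrow> w \<in> T \<Longrightarrow> \<omega> \<alpha> v w = 0) \<Longrightarrow> v = 0"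
  shows "\<exists>\<theta> b.
    basis_family (ks_index n k) \<theta> (dual_space T) \<and>
    basis_family (ks_index n k) b T \<and>
    dual_families (ks_index n k) \<theta> b \<and>
    (\<forall>\<beta>\<in>{1..k}. \<forall>u\<in>T. \<forall>v\<in>T.
       \<omega> \<beta> u v = (\<Sum>i\<in>{1..n}. wedge (\<theta> (Inl i)) (\<theta> (Inr (\<beta>, i))) u v)) \<and>
    internal_direct_sum {1..k} (\<lambda>\<beta>. span {b (Inr (\<beta>, i)) |i. i \<in> {1..n}}) V"
proof -
  let ?N = "{1..n}" and ?K = "{1..k}"
  have indX: "inj_on X {1..n * k}" "independent (X ` {1..n * k})"
    and spX: "span (X ` {1..n * k}) = V"
    using X by (auto simp: basis_family_def)
  have V: "subspace V" using spX subspace_span by metis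
  have XV: "X ` {1..n * k} \<subseteq> V" using spX span_superset by metis
  have inT: "v \<in> T" if "v \<in> V" for v using that VT by blast
  have add: "\<omega> \<alpha> (u + v) w = \<omega> \<alpha> u w + \<omega> \<alpha> v w" "\<omega> \<alpha> w (u + v) = \<omega> \<alpha> w u + \<omega> \<alpha> w v"
    if "\<alpha> \<in> ?K" "u \<in> T" "v \<in> T" "w \<in> T" for \<alpha> u v w
    using alt[OF that(1)] that unfolding alternating_bilinear_on_def by blast+
  have antisym: "\<omega> \<alpha> u v = - \<omega> \<alpha> v u" if "\<alpha> \<in> ?K" "u \<in> T" "v \<in> T" for \<alpha> u v
    using alternating_bilinear_on_antisym[OF alt T] that by blast

  obtain B where B: "X ` {1..n * k} \<subseteq> B" "B \<subseteq> T" "independent B" "T \<subseteq> span B"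
    using maximal_independent_subset_extend[of "X ` {1..n * k}" T] indX(2) XV VT by blast
  have spB: "span B = T" using B(2,4) span_minimal[OF _ T] by blast
  define C where "C = B - X ` {1..n * k}"
  have fB: "finite B" "card B \<le> n * (k + 1)" using bound B by auto
  then have fC: "finite C" by (simp add: C_def)
  have CT: "c \<in> T" if "c \<in> C" for c using that B(2) by (auto simp: C_def)
  have "card C = card B - n * k"
    unfolding C_def using card_Diff_subset[OF _ B(1)] card_image[OF indX(1)] by simp
  with fB have C_le: "card C \<le> n" by simp

  (* C is a basis of T modulo V, so the functionals below are the coordinates of the map
     from V into the k-fold sum of the dual of T / V. *)
  let ?J = "?K \<times> C"
  let ?\<phi> = "\<lambda>p v. if v \<in> V then \<omega> (fst p) v (snd p) else 0"
  have \<phi>: "?\<phi> p \<in> dual_space V" if "p \<in> ?J" for p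
    using contraction_in_dual_space(1)[OF alt V VT CT, of "fst p" "snd p"] that by auto
  have sep: "v = 0" if v: "v \<in> V" and 0: "\<And>p. p \<in> ?J \<Longrightarrow> ?\<phi> p v = 0" for v
  proof (rule nondeg[OF inT[OF v]])
    fix \<alpha> w assume \<alpha>: "\<alpha> \<in> ?K" and w: "w \<in> T"
    have "(\<lambda>w. if w \<in> T then \<omega> \<alpha> v w else 0) \<in> dual_space (span B)"
      using contraction_in_dual_space(2)[OF alt[OF \<alpha>] T order_refl inT[OF v]] spB by simp
    moreover have "(\<lambda>w. 0) \<in> dual_space (span B)"
      by (simp add: dual_space_def)
    moreover have "\<omega> \<alpha> v w = 0" if "w \<in> B" for w
      using 0[of "(\<alpha>, w)"] iso[OF \<alpha> v] \<alpha> v that XV by (cases "w \<in> C") (auto simp: C_def)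
    ultimately have "(\<lambda>w. if w \<in> T then \<omega> \<alpha> v w else 0) = (\<lambda>w. 0)"
      by (intro dual_space_eq_on_span[of _ B]) auto
    from fun_cong[OF this, of w] w show "\<omega> \<alpha> v w = 0" by simp
  qed
  have "n * k \<le> k * card C"
    using separating_functionals(1)[of ?J, OF _ X \<phi> sep] fC by (simp add: card_cartesian_product)
  with k C_le have C_n: "card C = n" by (simp add: mult.commute)
  then obtain e' where e': "bij_betw e' ?N C"
    using ex_bij_betw_nat_finite_1[OF fC] by blast
  have e'C: "e' j \<in> C" if "j \<in> ?N" for j using e' that by (auto simp: bij_betw_def)
  then have e'T: "e' j \<in> T" if "j \<in> ?N" for j using that CT by blast
  have uniq: "v = 0" if v: "v \<in> V" and 0: "\<And>\<alpha> j. \<alpha> \<in> ?K \<Longrightarrow> j \<in> ?N \<Longrightarrow> \<omega> \<alpha> v (e' j) = 0" for v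
  proof (rule sep[OF v])
    fix p assume "p \<in> ?J"
    then obtain \<alpha> j where "p = (\<alpha>, e' j)" "\<alpha> \<in> ?K" "j \<in> ?N"
      using bij_betw_imp_surj_on[OF e'] by auto
    with 0 show "?\<phi> p v = 0" by simp
  qed
  have solve: "\<exists>v\<in>V. \<forall>\<alpha>\<in>?K. \<forall>j\<in>?N. \<omega> \<alpha> v (e' j) = f \<alpha> j" for f :: "nat \<Rightarrow> nat \<Rightarrow> real"
  proof -
    let ?f = "\<lambda>p. f (fst p) (inv_into ?N e' (snd p))"
    have "finite ?J" "card {1..n * k} = card ?J"
      using C_n fC by (simp_all add: card_cartesian_product)
    then obtain v where v: "v \<in> V" "\<forall>p\<in>?J. ?\<phi> p v = ?f p"
      using separating_functionals(2)[where \<phi> = ?\<phi> and f = ?f, OF _ X \<phi> sep] by blast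
    have "\<omega> \<alpha> v (e' j) = f \<alpha> j" if "\<alpha> \<in> ?K" "j \<in> ?N" for \<alpha> j
      using bspec[OF v(2), of "(\<alpha>, e' j)"] v(1) that e'C e' by (simp add: bij_betw_def)
    with v(1) show ?thesis by blast
  qed

  (* The factor 1/2 is due to antisymmetry: w i and w j contribute equally to the value on
     (e i, e j), and together they cancel the value on (e' i, e' j). *)
  have "\<exists>w. w \<in> V \<and> (\<forall>\<alpha>\<in>?K. \<forall>j\<in>?N. \<omega> \<alpha> w (e' j) = - \<omega> \<alpha> (e' i) (e' j) / 2)" for i
    using solve[of "\<lambda>\<alpha> j. - \<omega> \<alpha> (e' i) (e' j) / 2"] by blast
  then obtain w where
    w: "\<And>i. w i \<in> V \<and> (\<forall>\<alpha>\<in>?K. \<forall>j\<in>?N. \<omega> \<alpha> (w i) (e' j) = - \<omega> \<alpha> (e' i) (e' j) / 2)"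
    by metis
  have wV: "w i \<in> V" for i using w by blast
  define e where "e i = e' i + w i" for i
  have eT: "e i \<in> T" if "i \<in> ?N" for i
    unfolding e_def using that e'T wV inT subspace_add[OF T] by blast
  (* The value is - 1 because e j, and not d p, is the first argument of the form in the
     duality relation. *)
  have "\<exists>v. v \<in> V \<and> (\<forall>\<alpha>\<in>?K. \<forall>j\<in>?N. \<omega> \<alpha> v (e' j) = (if p = (\<alpha>, j) then - 1 else 0))" for p
    using solve[of "\<lambda>\<alpha> j. if p = (\<alpha>, j) then - 1 else 0"] by blast
  then obtain d where
    d: "\<And>p. d p \<in> V \<and> (\<forall>\<alpha>\<in>?K. \<forall>j\<in>?N. \<omega> \<alpha> (d p) (e' j) = (if p = (\<alpha>, j) then - 1 else 0))"
    by metis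
  have dV: "d p \<in> V" for p using d by blast
  have de': "\<omega> \<alpha> (d p) (e' j) = (if p = (\<alpha>, j) then - 1 else 0)" if "\<alpha> \<in> ?K" "j \<in> ?N" for \<alpha> p j
    using d that by blast

  have ee: "\<omega> \<alpha> (e i) (e j) = 0" if "\<alpha> \<in> ?K" "i \<in> ?N" "j \<in> ?N" for \<alpha> i j
  proof -
    note T' = e'T[OF that(2)] e'T[OF that(3)] inT[OF wV[of i]] inT[OF wV[of j]]
    have "\<omega> \<alpha> (e i) (e j) =
        \<omega> \<alpha> (e' i) (e' j) + \<omega> \<alpha> (e' i) (w j) + (\<omega> \<alpha> (w i) (e' j) + \<omega> \<alpha> (w i) (w j))"
      unfolding e_def using that(1) T' by (simp add: add subspace_add[OF T])
    moreover have "\<omega> \<alpha> (w i) (w j) = 0" using iso that(1) wV by blast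
    moreover have "\<omega> \<alpha> (w i) (e' j) = - \<omega> \<alpha> (e' i) (e' j) / 2"
      "\<omega> \<alpha> (w j) (e' i) = - \<omega> \<alpha> (e' j) (e' i) / 2" using w that by blast+
    moreover have "\<omega> \<alpha> (e' i) (w j) = - \<omega> \<alpha> (w j) (e' i)"
      "\<omega> \<alpha> (e' i) (e' j) = - \<omega> \<alpha> (e' j) (e' i)" using antisym that(1) T' by blast+
    ultimately show ?thesis by simp
  qed
  have dd: "\<omega> \<alpha> (d p) (d q) = 0" if "\<alpha> \<in> ?K" for \<alpha> p q
    using iso that dV by blast
  have de: "\<omega> \<alpha> (d p) (e j) = (if p = (\<alpha>, j) then - 1 else 0)" if "\<alpha> \<in> ?K" "j \<in> ?N" for \<alpha> p j
    using add(2)[OF that(1) e'T[OF that(2)] inT[OF wV] inT[OF dV]] de'[OF that]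
      iso[OF that(1) dV wV] by (simp add: e_def)
  have ed: "\<omega> \<alpha> (e j) (d p) = (if p = (\<alpha>, j) then 1 else 0)" if "\<alpha> \<in> ?K" "j \<in> ?N" for \<alpha> p j
    using antisym[OF that(1) eT[OF that(2)] inT[OF dV]] de[OF that] by simp

  have spd: "span (d ` (?K \<times> ?N)) = V"
  proof (intro equalityI subsetI)
    fix v assume "v \<in> span (d ` (?K \<times> ?N))"
    moreover have "span (d ` (?K \<times> ?N)) \<subseteq> V"
      by (intro span_minimal V) (use dV in blast)
    ultimately show "v \<in> V" by blast
  next
    fix v assume v: "v \<in> V"
    (* By the sign in the duality relation, - s is the expansion of v. *)
    define s where "s = (\<Sum>p\<in>?K \<times> ?N. \<omega> (fst p) v (e' (snd p)) *\<^sub>R d p)"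
    have sV: "s \<in> V" unfolding s_def by (intro subspace_sum subspace_scale V dV)
    have "v + s = 0"
    proof (rule uniq)
      show "v + s \<in> V" using v sV V subspace_add by blast
      fix \<alpha> j assume \<alpha>: "\<alpha> \<in> ?K" and j: "j \<in> ?N"
      have \<psi>: "?\<phi> (\<alpha>, e' j) \<in> dual_space V"
        using \<phi>[of "(\<alpha>, e' j)"] \<alpha> e'C[OF j] by blast
      have "\<omega> \<alpha> s (e' j) = ?\<phi> (\<alpha>, e' j) s" using sV by simp
      also have "\<dots> = (\<Sum>p\<in>?K \<times> ?N. ?\<phi> (\<alpha>, e' j) (\<omega> (fst p) v (e' (snd p)) *\<^sub>R d p))"
        unfolding s_def by (intro dual_space_sum[OF V \<psi>] subspace_scale V dV)
      also have "\<dots> = (\<Sum>p\<in>?K \<times> ?N. if p = (\<alpha>, j) then - \<omega> \<alpha> v (e' j) else 0)"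
        using dual_space_scale[OF \<psi> dV] de'[OF \<alpha> j] dV by (intro sum.cong) auto
      also have "\<dots> = - \<omega> \<alpha> v (e' j)" using \<alpha> j by simp
      finally show "\<omega> \<alpha> (v + s) (e' j) = 0"
        using add(1)[OF \<alpha> inT[OF v] inT[OF sV] e'T[OF j]] by simp
    qed
    then have "v = - s" by (simp add: eq_neg_iff_add_eq_0)
    also have "\<dots> \<in> span (d ` (?K \<times> ?N))"
      unfolding s_def by (intro span_neg span_sum span_scale span_base) auto
    finally show "v \<in> span (d ` (?K \<times> ?N))" .
  qed

  let ?I = "ks_index n k"
  define b where "b = case_sum e d"
  (* Inserting a basis vector into the desired formula expresses the dual basis by the forms.
     The functional dual to e i is a contraction of each of the k forms; the first is taken. *)
  define \<theta> where "\<theta> = case_sum (\<lambda>i v. if v \<in> T then \<omega> 1 v (d (1, i)) else 0)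
    (\<lambda>p v. if v \<in> T then \<omega> (fst p) (e (snd p)) v else 0)"
  have bT: "b p \<in> T" if "p \<in> ?I" for p
    using that eT inT[OF dV] by (auto simp: b_def)
  have "span (b ` ?I) = T"
  proof (intro equalityI)
    show "span (b ` ?I) \<subseteq> T" by (intro span_minimal T) (use bT in blast)
    have "d ` (?K \<times> ?N) \<subseteq> b ` ?I"
    proof
      fix v assume "v \<in> d ` (?K \<times> ?N)"
      then obtain p where "p \<in> ?K \<times> ?N" "v = b (Inr p)" by (auto simp: b_def)
      then show "v \<in> b ` ?I" by blast
    qed
    then have Vb: "V \<subseteq> span (b ` ?I)" using spd span_mono by metis
    have "e' j \<in> span (b ` ?I)" if "j \<in> ?N" for j
    proof -
      have "e j \<in> b ` ?I" using that by (intro image_eqI[of _ _ "Inl j"]) (auto simp: b_def)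
      then have "e j - w j \<in> span (b ` ?I)"
        using span_diff[OF span_base subsetD[OF Vb wV]] by blast
      then show ?thesis by (simp add: e_def)
    qed
    then have "C \<subseteq> span (b ` ?I)" using bij_betw_imp_surj_on[OF e'] by blast
    then have "B \<subseteq> span (b ` ?I)" using Vb XV by (auto simp: C_def)
    then show "T \<subseteq> span (b ` ?I)" using spB span_minimal[OF _ subspace_span] by metis
  qed
  note spb = this
  have one: "1 \<in> ?K" using k by simp
  have \<theta>D: "\<theta> p \<in> dual_space T" if p: "p \<in> ?I" for p
  proof (cases p)
    case (Inl i)
    then show ?thesis
      using contraction_in_dual_space(1)[OF alt[OF one] T order_refl inT[OF dV]]
      by (simp add: \<theta>_def)
  next
    case (Inr q)
    then have "fst q \<in> ?K" "snd q \<in> ?N" using p by auto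
    with Inr show ?thesis
      using contraction_in_dual_space(2)[OF alt T order_refl eT] by (simp add: \<theta>_def)
  qed
  have dual: "dual_families ?I \<theta> b"
    unfolding dual_families_def
  proof (intro ballI)
    fix p q assume pq: "p \<in> ?I" "q \<in> ?I"
    show "\<theta> p (b q) = (if p = q then 1 else 0)"
      using pq bT[OF pq(2)] one
      by (auto simp: \<theta>_def b_def ed ee dd split: if_splits)
  qed
  have \<theta>b: "\<theta> p (b q) = (if p = q then 1 else 0)" if "p \<in> ?I" "q \<in> ?I" for p q
    using dual that by (auto simp: dual_families_def)
  have "finite ?I" by simp
  note bases = dual_families_basis[OF this spb \<theta>D dual]
  have forms: "\<omega> \<beta> u v = (\<Sum>i\<in>?N. wedge (\<theta> (Inl i)) (\<theta> (Inr (\<beta>, i))) u v)"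
    if \<beta>: "\<beta> \<in> ?K" and uv: "u \<in> T" "v \<in> T" for \<beta> u v
  proof (rule alternating_bilinear_on_eq_on_span[of "b ` ?I"])
    show "alternating_bilinear_on (span (b ` ?I)) (\<omega> \<beta>)" using alt \<beta> spb by simp
    show "alternating_bilinear_on (span (b ` ?I))
        (\<lambda>u v. \<Sum>i\<in>?N. wedge (\<theta> (Inl i)) (\<theta> (Inr (\<beta>, i))) u v)"
      unfolding spb using \<beta> by (intro alternating_bilinear_on_sum_wedge \<theta>D) auto
    show "u \<in> span (b ` ?I)" "v \<in> span (b ` ?I)" using uv spb by auto
    fix x y assume "x \<in> b ` ?I" "y \<in> b ` ?I"
    then obtain p q where pq: "p \<in> ?I" "q \<in> ?I" "x = b p" "y = b q" by blast
    let ?s = "\<lambda>p q i. if Inl i = p \<and> Inr (\<beta>, i) = q then 1 else 0 :: real"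
    have single: "(\<Sum>i\<in>?N. ?s (Inl j) (Inr r) i) = (if r = (\<beta>, j) then 1 else 0)"
      if "j \<in> ?N" for j r
    proof -
      have "(\<Sum>i\<in>?N. ?s (Inl j) (Inr r) i) = (\<Sum>i\<in>?N. if i = j then if r = (\<beta>, j) then 1 else 0 else 0)"
        by (rule sum.cong) auto
      with that show ?thesis by simp
    qed
    have mult_if: "(if P then 1 else 0) * (if Q then 1 else 0) = (if P \<and> Q then 1 else 0 :: real)"
      for P Q by simp
    have "wedge (\<theta> (Inl i)) (\<theta> (Inr (\<beta>, i))) x y = ?s p q i - ?s q p i" if "i \<in> ?N" for i
    proof -
      have m: "Inl i \<in> ?I" "Inr (\<beta>, i) \<in> ?I" using that \<beta> by auto
      show ?thesis
        by (simp only: pq(3,4) wedge_def \<theta>b[OF m(1) pq(1)] \<theta>b[OF m(1) pq(2)]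
            \<theta>b[OF m(2) pq(1)] \<theta>b[OF m(2) pq(2)] mult_if)
    qed
    then have "(\<Sum>i\<in>?N. wedge (\<theta> (Inl i)) (\<theta> (Inr (\<beta>, i))) x y) =
        (\<Sum>i\<in>?N. ?s p q i) - (\<Sum>i\<in>?N. ?s q p i)"
      by (simp add: sum_subtractf)
    also have "\<dots> = \<omega> \<beta> (b p) (b q)"
    proof (cases p)
      case p: (Inl i)
      then have i: "i \<in> ?N" using pq(1) by auto
      show ?thesis
      proof (cases q)
        case (Inl j)
        with pq(2) have "j \<in> ?N" by auto
        with Inl p show ?thesis using ee[OF \<beta> i] by (simp add: b_def)
      next
        case (Inr r)
        with p show ?thesis using single[OF i, of r] ed[OF \<beta> i, of r] by (simp add: b_def)
      qed
    next
      case p: (Inr r)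
      show ?thesis
      proof (cases q)
        case (Inl j)
        with pq(2) have j: "j \<in> ?N" by auto
        with Inl p show ?thesis using single[OF j, of r] de[OF \<beta> j, of r] by (simp add: b_def)
      next
        case (Inr r')
        with p show ?thesis using dd[OF \<beta>] by (simp add: b_def)
      qed
    qed
    finally show "\<omega> \<beta> x y = (\<Sum>i\<in>?N. wedge (\<theta> (Inl i)) (\<theta> (Inr (\<beta>, i))) x y)"
      using pq by simp
  qed
  have "inj_on d (?K \<times> ?N) \<and> independent (d ` (?K \<times> ?N))"
  proof -
    have "inj_on b ?I" "independent (b ` ?I)"
      using bases(1) by (auto simp: basis_family_def)
    moreover have "d = b \<circ> Inr" by (auto simp: b_def)
    moreover have "Inr ` (?K \<times> ?N) \<subseteq> ?I" by auto
    ultimately show ?thesis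
      by (metis comp_inj_on image_comp image_mono independent_mono inj_Inr inj_on_subset subset_UNIV)
  qed
  then have "internal_direct_sum ?K (\<lambda>\<beta>. span {d (\<beta>, i) |i. i \<in> ?N}) V"
    using internal_direct_sum_blocks[of ?K d ?N] spd by simp
  then have "internal_direct_sum ?K (\<lambda>\<beta>. span {b (Inr (\<beta>, i)) |i. i \<in> ?N}) V"
    by (simp add: b_def)
  with bases dual forms show ?thesis
    by (intro exI[of _ \<theta>] exI[of _ b]) blast
qed

section \<open>The tangent space\<close>

lemma transition_derivative_linear:
  assumes "smooth_manifold M A" "c \<in> A" "d \<in> A" "x \<in> chart_dom c" "x \<in> chart_dom d"
  shows "linear (frechet_derivative (transition c d) (at (chart_map c x)))"
proof -
  have "smooth_on (chart_map c ` (chart_dom c \<inter> chart_dom d)) (transition c d)"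
    using assms by (simp add: smooth_manifold_def)
  then have "Ck_on (Suc 0) (transition c d) (chart_map c ` (chart_dom c \<inter> chart_dom d))"
    unfolding smooth_on_def by blast
  then have "transition c d differentiable at (chart_map c x)"
    using assms(4,5) by simp
  then show ?thesis by (rule linear_frechet_derivative)
qed

lemma subspace_tangent_space:
  assumes "smooth_manifold M A"
  shows "subspace (tangent_space A x)"
proof -
  let ?D = "\<lambda>c d. frechet_derivative (transition c d) (at (chart_map c x))"
  let ?ov = "\<lambda>c d. c \<in> A \<and> d \<in> A \<and> x \<in> chart_dom c \<and> x \<in> chart_dom d"
  have mem: "v \<in> tangent_space A x \<longleftrightarrow> (\<forall>c d. ?ov c d \<longrightarrow> v d = ?D c d (v c)) \<and>
      (\<forall>c. \<not> (c \<in> A \<and> x \<in> chart_dom c) \<longrightarrow> v c = 0)" for v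
    unfolding tangent_space_def by blast
  have lin: "linear (?D c d)" if "?ov c d" for c d
    using transition_derivative_linear[OF assms] that by blast
  have D: "?D c d 0 = 0" "?D c d (a + a') = ?D c d a + ?D c d a'" "?D c d (r *\<^sub>R a) = r *\<^sub>R ?D c d a"
    if "?ov c d" for c d a a' r
    using lin[OF that] by (simp_all add: linear_0 linear_add linear_scale)
  show ?thesis
    unfolding subspace_def
  proof (intro conjI ballI allI)
    show "0 \<in> tangent_space A x"
      unfolding mem by (simp add: D)
    fix u assume u: "u \<in> tangent_space A x"
    show "u + v \<in> tangent_space A x" if "v \<in> tangent_space A x" for v
    proof (unfold mem, intro conjI allI impI)
      fix c d assume cd: "?ov c d"
      then have "u d = ?D c d (u c)" "v d = ?D c d (v c)"
        using u that unfolding mem by blast+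
      then show "(u + v) d = ?D c d ((u + v) c)"
        unfolding plus_fun_apply D[OF cd] by (rule arg_cong2)
    next
      fix c assume "\<not> (c \<in> A \<and> x \<in> chart_dom c)"
      then have "u c = 0" "v c = 0" using u that unfolding mem by blast+
      then show "(u + v) c = 0" by simp
    qed
    show "r *\<^sub>R u \<in> tangent_space A x" for r
    proof (unfold mem, intro conjI allI impI)
      fix c d assume cd: "?ov c d"
      then have "u d = ?D c d (u c)" using u unfolding mem by blast
      then show "(r *\<^sub>R u) d = ?D c d ((r *\<^sub>R u) c)"
        unfolding scaleR_fun_def D[OF cd] by (rule arg_cong)
    next
      fix c assume "\<not> (c \<in> A \<and> x \<in> chart_dom c)"
      then have "u c = 0" using u unfolding mem by blast
      then show "(r *\<^sub>R u) c = 0" by (simp add: scaleR_fun_def)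
    qed
  qed
qed

text \<open>Evaluation in the chart \<open>c\<close> is injective on the tangent space: the components in any other
  chart are the image of those in \<open>c\<close> under a linear map.\<close>

lemma card_independent_tangent_vectors:
  fixes A :: "('m, 'e::euclidean_space) chart set"
  assumes M: "smooth_manifold M A" and c: "c \<in> A" "x \<in> chart_dom c"
    and B: "independent B" "B \<subseteq> tangent_space A x"
  shows "finite B \<and> card B \<le> DIM('e)"
proof -
  let ?T = "tangent_space A x"
  have lin: "linear (\<lambda>v. v c :: 'e)"
    by (rule linearI) (auto simp: scaleR_fun_def)
  have "v = 0" if "v \<in> ?T" "v c = 0" for v
  proof
    fix d
    show "v d = 0 d"
    proof (cases "d \<in> A \<and> x \<in> chart_dom d")
      case True
      then have "v d = frechet_derivative (transition c d) (at (chart_map c x)) (v c)"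
        using that(1) c unfolding tangent_space_def by blast
      also have "\<dots> = 0"
        using linear_0[OF transition_derivative_linear[OF M c(1) _ c(2), of d]] True that(2) by simp
      finally show ?thesis by simp
    next
      case False
      then have "v d = 0" using that(1) unfolding tangent_space_def by blast
      then show ?thesis by simp
    qed
  qed
  then have inj: "inj_on (\<lambda>v. v c) ?T"
    using linear_injective_on_subspace_0[OF lin subspace_tangent_space[OF M]] by blast
  moreover have "span B \<subseteq> ?T"
    by (rule span_minimal[OF B(2) subspace_tangent_space[OF M]])
  ultimately have "independent ((\<lambda>v. v c) ` B)"
    using linear_independent_injective_image[OF lin B(1)] inj_on_subset by blast
  then have "finite ((\<lambda>v. v c) ` B)" "card ((\<lambda>v. v c) ` B) \<le> DIM('e)"
    using independent_bound by auto
  moreover have "inj_on (\<lambda>v. v c) B" using inj B(2) by (rule inj_on_subset)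
  ultimately show ?thesis by (simp add: card_image finite_image_iff)
qed

theorem theorem3p2:
  fixes n k :: nat
    and M :: "'m topology"
    and A :: "('m, 'e::euclidean_space) chart set"
    and \<omega> :: "nat \<Rightarrow> ('m, 'e) tensor2"
    and V :: "'m \<Rightarrow> ('m, 'e) tvec set"
  assumes "k_symplectic_manifold n k M A \<omega> V"
    and "x \<in> topspace M"
  shows "\<exists>\<theta> b.
    basis_family (ks_index n k) \<theta> (cotangent_space A x) \<and>
    basis_family (ks_index n k) b (tangent_space A x) \<and>
    dual_families (ks_index n k) \<theta> b \<and>
    (\<forall>\<beta>\<in>{1..k}. \<forall>u\<in>tangent_space A x. \<forall>v\<in>tangent_space A x.
       \<omega> \<beta> x u v = (\<Sum>i\<in>{1..n}. wedge (\<theta> (Inl i)) (\<theta> (Inr (\<beta>, i))) u v)) \<and>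
    internal_direct_sum {1..k} (\<lambda>\<beta>. span {b (Inr (\<beta>, i)) |i. i \<in> {1..n}}) (V x)"
proof -
  let ?T = "tangent_space A x"
  note ks = assms(1)[unfolded k_symplectic_manifold_def]
  have M: "smooth_manifold M A" and DIM: "DIM('e) = n * (k + 1)"
    and forms: "\<forall>\<alpha>\<in>{1..k}. two_form M A (\<omega> \<alpha>)"
    and ker: "(\<Inter>\<alpha>\<in>{1..k}. form_kernel A (\<omega> \<alpha>) x) = {0}"
    using ks assms(2) by auto
  obtain c where c: "c \<in> A" "x \<in> chart_dom c"
    using M assms(2) unfolding smooth_manifold_def by blast
  have "distribution M A (n * k) V"
    using ks by (simp add: integrable_distribution_def)
  then obtain X where X: "V x \<subseteq> ?T" "basis_family {1..n * k} X (V x)"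
    using assms(2) unfolding distribution_def by blast
  (* An intersection over the empty index set is the whole type, which is not trivial. *)
  have "k \<noteq> 0"
  proof
    assume "k = 0"
    then have "(UNIV :: ('m, 'e) tvec set) = {0}" using ker by simp
    moreover obtain h :: 'e where "h \<noteq> 0" using nonempty_Basis nonzero_Basis by blast
    ultimately have "(\<lambda>_. h) = (0 :: ('m, 'e) tvec)" by blast
    with \<open>h \<noteq> 0\<close> show False by (simp add: fun_eq_iff)
  qed
  show ?thesis
  proof (rule polarized_forms_normal_form[OF subspace_tangent_space[OF M] _ X])
    show "finite B \<and> card B \<le> n * (k + 1)" if "independent B" "B \<subseteq> ?T" for B
      using card_independent_tangent_vectors[OF M c that] DIM by simp
    show "0 < k" using \<open>k \<noteq> 0\<close> by simp
    show "alternating_bilinear_on ?T (\<omega> \<alpha> x)" if "\<alpha> \<in> {1..k}" for \<alpha>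
      using forms that assms(2) by (auto simp: two_form_def)
    show "\<omega> \<alpha> x u v = 0" if "\<alpha> \<in> {1..k}" "u \<in> V x" "v \<in> V x" for \<alpha> u v
      using ks that assms(2) by blast
    show "v = 0" if "v \<in> ?T" "\<And>\<alpha> w. \<alpha> \<in> {1..k} \<Longrightarrow> w \<in> ?T \<Longrightarrow> \<omega> \<alpha> x v w = 0" for v
      using that ker by (auto simp: form_kernel_def)
  qed
qed

end
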